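(* Assume that the unperturbed system $\dot x=X^0(x)$ on $\mathscr{M}$ has a homoclinic orbit $\gamma^{\mathrm h}(t)$ to a $T$-periodic orbit $\gamma^{\mathrm p}(t)$ (where $\gamma^{\mathrm p}$ may be an equilibrium), and that it has a non-constant $C^3$ first integral $F(x)$ near $\Gamma^{\mathrm h}=\{\gamma^{\mathrm h}(t)\mid t\in\mathbb{R}\}\cup\Gamma^{\mathrm p}$, where $\Gamma^{\mathrm p}=\{\gamma^{\mathrm p}(t)\mid t\in[0,T)\}$. If the perturbed system $\dot x=X_\varepsilon(x)$ has a $C^3$ first integral $F_\varepsilon$ depending $C^2$-smoothly on $\varepsilon$ near $\Gamma^{\mathrm h}$ such that $F_0=F$, then the limit $$\tilde{\mathscr{I}}_{F,\gamma^{\mathrm h}}:=\lim_{k\to+\infty}\int_{T_{-k}}^{T_k}dF(X^1)(\gamma^{\mathrm h}(t))\,dt$$ exists and $\tilde{\mathscr{I}}_{F,\gamma^{\mathrm h}}=0$, where $\{T_j\}_{j\in\mathbb{Z}}$ is the time sequence described in the context.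
   Context: $\mathscr{M}$ is an $n$-dimensional ($n\ge 2$) paracompact oriented $C^3$ real manifold. $\varepsilon$ is a small parameter, $0\le\varepsilon\ll 1$, and $X_\varepsilon$ is a family of vector fields on $\mathscr{M}$ that is $C^2$ with respect to $x$ and $\varepsilon$, with $X_\varepsilon(x)=X^0(x)+\varepsilon X^1(x)+O(\varepsilon^2)$. A first integral $F$ of a vector field $X$ satisfies $dF(X)=0$. "Near $\Gamma^{\mathrm h}$" means on some neighborhood (independent of $\varepsilon$) of $\Gamma^{\mathrm h}$. Time sequence. If $\gamma^{\mathrm p}$ is not an equilibrium, let $x_0=\gamma^{\mathrm p}(0)$ and let $\Sigma$ be an $(n-1)$-dimensional hypersurface (Poincaré section) which $\gamma^{\mathrm p}$ intersects transversely at $x_0$, restricted to a sufficiently small neighborhood of $x_0$, so that $\gamma^{\mathrm h}(t)$ intersects $\Sigma$ transversely infinitely many times, at the times $T_j\in\mathbb{R}$, $T_{j-1}<T_j$, $j\in\mathbb{Z}$, with $\lim_{j\to\pm\infty}T_j=\pm\infty$; in particular $\lim_{j\to\pm\infty}\gamma^{\mathrm h}(T_j)=x_0$. If $\gamma^{\mathrm p}$ is an equilibrium, $\{T_j\}_{j\in\mathbb{Z}}$ is any sequence (strictly increasing) with $\lim_{j\to\pm\infty}T_j=\pm\infty$, and $\tilde{\mathscr{I}}_{F,\gamma^{\mathrm h}}=\int_{-\infty}^{\infty}dF(X^1)(\gamma^{\mathrm h}(t))\,dt$. *)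

theory Defs
  imports "HOL-Analysis.Analysis" "HOL-Library.Landau_Symbols"
begin

text \<open>
  Derivatives are taken within \<open>S\<close>. The sets used below are open sets and products of an open
  set with a half-open interval \<open>{0..<e}\<close>. On both, the derivative within the set is unique;
  in the second case it is one-sided in the last variable at \<open>0\<close>.
\<close>

primrec Ck_on ::
  "nat \<Rightarrow> ('a::euclidean_space \<Rightarrow> 'b::real_normed_vector) \<Rightarrow> 'a set \<Rightarrow> bool" where
  "Ck_on 0 f S \<longleftrightarrow> continuous_on S f"
| "Ck_on (Suc k) f S \<longleftrightarrow> f differentiable_on S \<and>
     (\<forall>v. Ck_on k (\<lambda>x. frechet_derivative f (at x within S) v) S)"

text \<open>A chart is a pair of its domain and its coordinate map; the values of the coordinate map
  outside the domain are irrelevant.\<close>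

type_synonym ('a, 'n) chart = "'a set \<times> ('a \<Rightarrow> real ^ 'n)"

definition chart_inv :: "('a, 'n::finite) chart \<Rightarrow> real ^ 'n \<Rightarrow> 'a" where
  "chart_inv c = inv_into (fst c) (snd c)"

definition is_chart :: "'a topology \<Rightarrow> ('a, 'n::finite) chart \<Rightarrow> bool" where
  "is_chart M c \<longleftrightarrow> openin M (fst c) \<and> open (snd c ` fst c) \<and>
     homeomorphic_map (subtopology M (fst c)) (top_of_set (snd c ` fst c)) (snd c)"

definition transition ::
  "('a, 'n::finite) chart \<Rightarrow> ('a, 'n) chart \<Rightarrow> real ^ 'n \<Rightarrow> real ^ 'n" where
  "transition c d = snd d \<circ> chart_inv c"

definition oriented_Ck_atlas :: "nat \<Rightarrow> 'a topology \<Rightarrow> ('a, 'n::finite) chart set \<Rightarrow> bool" where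
  "oriented_Ck_atlas k M A \<longleftrightarrow>
     (\<forall>c\<in>A. is_chart M c) \<and> (\<Union>c\<in>A. fst c) = topspace M \<and>
     (\<forall>c\<in>A. \<forall>d\<in>A. Ck_on k (transition c d) (snd c ` (fst c \<inter> fst d)) \<and>
        (\<forall>y\<in>snd c ` (fst c \<inter> fst d).
           0 < det (matrix (frechet_derivative (transition c d) (at y)))))"

definition paracompact_space :: "'a topology \<Rightarrow> bool" where
  "paracompact_space M \<longleftrightarrow>
     (\<forall>\<U>. (\<forall>U\<in>\<U>. openin M U) \<and> \<Union>\<U> = topspace M \<longrightarrow>
        (\<exists>\<V>. (\<forall>V\<in>\<V>. openin M V) \<and> \<Union>\<V> = topspace M \<and>
           (\<forall>V\<in>\<V>. \<exists>U\<in>\<U>. V \<subseteq> U) \<and> locally_finite_in M \<V>))"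

definition paracompact_oriented_Ck_manifold ::
  "nat \<Rightarrow> 'a topology \<Rightarrow> ('a, 'n::finite) chart set \<Rightarrow> bool" where
  "paracompact_oriented_Ck_manifold k M A \<longleftrightarrow>
     Hausdorff_space M \<and> paracompact_space M \<and> oriented_Ck_atlas k M A"

definition Ck_function ::
  "nat \<Rightarrow> ('a, 'n::finite) chart set \<Rightarrow> 'a set \<Rightarrow> ('a \<Rightarrow> real) \<Rightarrow> bool" where
  "Ck_function k A N F \<longleftrightarrow> (\<forall>c\<in>A. Ck_on k (F \<circ> chart_inv c) (snd c ` (fst c \<inter> N)))"

text \<open>A tangent vector at \<open>p\<close> is the family of its coordinate vectors in all charts around \<open>p\<close>,
  related by the Jacobians of the transition maps.  (Derivations of germs are not an option:
  for finite differentiability class they form an infinite-dimensional space.)\<close>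

type_synonym ('a, 'n) tvec = "('a, 'n) chart \<Rightarrow> real ^ 'n"

definition tangent_vector ::
  "('a, 'n::finite) chart set \<Rightarrow> 'a \<Rightarrow> ('a, 'n) tvec \<Rightarrow> bool" where
  "tangent_vector A p v \<longleftrightarrow>
     (\<forall>c\<in>A. \<forall>d\<in>A. p \<in> fst c \<inter> fst d \<longrightarrow>
        v d = frechet_derivative (transition c d) (at (snd c p)) (v c))"

definition vector_field ::
  "'a topology \<Rightarrow> ('a, 'n::finite) chart set \<Rightarrow> ('a \<Rightarrow> ('a, 'n) tvec) \<Rightarrow> bool" where
  "vector_field M A X \<longleftrightarrow> (\<forall>p\<in>topspace M. tangent_vector A p (X p))"

definition chart_at :: "('a, 'n::finite) chart set \<Rightarrow> 'a \<Rightarrow> ('a, 'n) chart" where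
  "chart_at A p = (SOME c. c \<in> A \<and> p \<in> fst c)"

text \<open>\<open>dF\<^sub>p(v)\<close>. By the chain rule, for \<open>F\<close> differentiable at \<open>p\<close> and a tangent vector \<open>v\<close> at \<open>p\<close>
  the value does not depend on the chosen chart.\<close>

definition mdiff ::
  "('a, 'n::finite) chart set \<Rightarrow> ('a \<Rightarrow> real) \<Rightarrow> 'a \<Rightarrow> ('a, 'n) tvec \<Rightarrow> real" where
  "mdiff A F p v =
     (let c = chart_at A p in frechet_derivative (F \<circ> chart_inv c) (at (snd c p)) (v c))"

text \<open>In both families the parameter ranges over \<open>0 \<le> \<epsilon> < e0\<close>, and the regularity is joint in the
  point and the parameter.\<close>

definition Ck_vector_field_family ::
  "nat \<Rightarrow> 'a topology \<Rightarrow> ('a, 'n::finite) chart set \<Rightarrow> real \<Rightarrow>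
     (real \<Rightarrow> 'a \<Rightarrow> ('a, 'n) tvec) \<Rightarrow> bool" where
  "Ck_vector_field_family k M A e0 X \<longleftrightarrow>
     (\<forall>\<epsilon>\<in>{0..<e0}. vector_field M A (X \<epsilon>)) \<and>
     (\<forall>c\<in>A. Ck_on k (\<lambda>(y, \<epsilon>). X \<epsilon> (chart_inv c y) c) ((snd c ` fst c) \<times> {0..<e0}))"

definition Ck_function_family ::
  "nat \<Rightarrow> ('a, 'n::finite) chart set \<Rightarrow> 'a set \<Rightarrow> real \<Rightarrow> (real \<Rightarrow> 'a \<Rightarrow> real) \<Rightarrow> bool" where
  "Ck_function_family k A N e0 F \<longleftrightarrow>
     (\<forall>c\<in>A. Ck_on k (\<lambda>(y, \<epsilon>). F \<epsilon> (chart_inv c y)) ((snd c ` (fst c \<inter> N)) \<times> {0..<e0}))"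

definition first_order_expansion ::
  "('a, 'n::finite) chart set \<Rightarrow> (real \<Rightarrow> 'a \<Rightarrow> ('a, 'n) tvec) \<Rightarrow>
     ('a \<Rightarrow> ('a, 'n) tvec) \<Rightarrow> ('a \<Rightarrow> ('a, 'n) tvec) \<Rightarrow> bool" where
  "first_order_expansion A X X0 X1 \<longleftrightarrow>
     (\<forall>c\<in>A. \<forall>p\<in>fst c.
        (\<lambda>\<epsilon>. norm (X \<epsilon> p c - (X0 p c + \<epsilon> *\<^sub>R X1 p c))) \<in> O[at_right 0](\<lambda>\<epsilon>. \<epsilon>\<^sup>2))"

definition first_integral ::
  "('a, 'n::finite) chart set \<Rightarrow> 'a set \<Rightarrow> ('a \<Rightarrow> ('a, 'n) tvec) \<Rightarrow> ('a \<Rightarrow> real) \<Rightarrow> bool" where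
  "first_integral A N X F \<longleftrightarrow> (\<forall>p\<in>N. mdiff A F p (X p) = 0)"

definition integral_curve ::
  "'a topology \<Rightarrow> ('a, 'n::finite) chart set \<Rightarrow> ('a \<Rightarrow> ('a, 'n) tvec) \<Rightarrow> (real \<Rightarrow> 'a) \<Rightarrow> bool"
  where
  "integral_curve M A X \<gamma> \<longleftrightarrow>
     continuous_map euclideanreal M \<gamma> \<and>
     (\<forall>t. \<forall>c\<in>A. \<gamma> t \<in> fst c \<longrightarrow> ((snd c \<circ> \<gamma>) has_vector_derivative X (\<gamma> t) c) (at t))"

text \<open>\<open>T\<close> need not be the minimal period, so that constant orbits are included.\<close>

definition periodic_orbit ::
  "'a topology \<Rightarrow> ('a, 'n::finite) chart set \<Rightarrow> ('a \<Rightarrow> ('a, 'n) tvec) \<Rightarrow> real \<Rightarrow>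
     (real \<Rightarrow> 'a) \<Rightarrow> bool" where
  "periodic_orbit M A X T \<gamma> \<longleftrightarrow>
     integral_curve M A X \<gamma> \<and> T > 0 \<and> (\<forall>t. \<gamma> (t + T) = \<gamma> t)"

definition is_equilibrium :: "(real \<Rightarrow> 'a) \<Rightarrow> bool" where
  "is_equilibrium \<gamma> \<longleftrightarrow> (\<forall>t. \<gamma> t = \<gamma> 0)"

text \<open>For the compact orbit \<open>\<Gamma>\<close> of a periodic solution, convergence to \<open>\<Gamma>\<close> is stated through
  open neighbourhoods of \<open>\<Gamma>\<close>; this needs no metric on \<open>M\<close>.\<close>

definition homoclinic_orbit ::
  "'a topology \<Rightarrow> ('a, 'n::finite) chart set \<Rightarrow> ('a \<Rightarrow> ('a, 'n) tvec) \<Rightarrow> 'a set \<Rightarrow>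
     (real \<Rightarrow> 'a) \<Rightarrow> bool" where
  "homoclinic_orbit M A X \<Gamma> \<gamma> \<longleftrightarrow>
     integral_curve M A X \<gamma> \<and> range \<gamma> \<inter> \<Gamma> = {} \<and>
     (\<forall>W. openin M W \<and> \<Gamma> \<subseteq> W \<longrightarrow>
        (\<forall>\<^sub>F t in at_top. \<gamma> t \<in> W) \<and> (\<forall>\<^sub>F t in at_bot. \<gamma> t \<in> W))"

text \<open>\<open>S\<close> is near \<open>p\<close> the zero set of \<open>g\<close>, a \<open>C\<^sup>1\<close> submersion to the reals on \<open>N\<close>;
  the tangent space of \<open>S\<close> at \<open>p\<close> is then the kernel of \<open>dg\<^sub>p\<close>.\<close>

definition local_defining_function ::
  "'a topology \<Rightarrow> ('a, 'n::finite) chart set \<Rightarrow> 'a set \<Rightarrow> 'a \<Rightarrow> 'a set \<Rightarrow> ('a \<Rightarrow> real) \<Rightarrow> bool"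
  where
  "local_defining_function M A S p N g \<longleftrightarrow>
     openin M N \<and> p \<in> N \<and> Ck_function 1 A N g \<and>
     (\<forall>q\<in>N. \<exists>v. tangent_vector A q v \<and> mdiff A g q v \<noteq> 0) \<and>
     S \<inter> N = {q \<in> N. g q = 0}"

definition hypersurface :: "'a topology \<Rightarrow> ('a, 'n::finite) chart set \<Rightarrow> 'a set \<Rightarrow> bool" where
  "hypersurface M A S \<longleftrightarrow>
     S \<subseteq> topspace M \<and> (\<forall>p\<in>S. \<exists>N g. local_defining_function M A S p N g)"

definition transverse_at ::
  "'a topology \<Rightarrow> ('a, 'n::finite) chart set \<Rightarrow> 'a set \<Rightarrow> 'a \<Rightarrow> ('a, 'n) tvec \<Rightarrow> bool" where
  "transverse_at M A S p v \<longleftrightarrow>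
     p \<in> S \<and> (\<exists>N g. local_defining_function M A S p N g \<and> mdiff A g p v \<noteq> 0)"

definition biinfinite_time_sequence :: "(int \<Rightarrow> real) \<Rightarrow> bool" where
  "biinfinite_time_sequence \<tau> \<longleftrightarrow>
     strict_mono \<tau> \<and> filterlim \<tau> at_top at_top \<and> filterlim \<tau> at_bot at_bot"

text \<open>\<open>\<tau>\<close> enumerates all times at which the integral curve \<open>\<gamma>\<close> of \<open>X\<close> meets \<open>S\<close>.\<close>

definition crossing_times ::
  "'a topology \<Rightarrow> ('a, 'n::finite) chart set \<Rightarrow> ('a \<Rightarrow> ('a, 'n) tvec) \<Rightarrow> 'a set \<Rightarrow>
     (real \<Rightarrow> 'a) \<Rightarrow> (int \<Rightarrow> real) \<Rightarrow> bool" where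
  "crossing_times M A X S \<gamma> \<tau> \<longleftrightarrow>
     biinfinite_time_sequence \<tau> \<and> {t. \<gamma> t \<in> S} = range \<tau> \<and>
     (\<forall>j. transverse_at M A S (\<gamma> (\<tau> j)) (X (\<gamma> (\<tau> j))))"

end

theory Submission
  imports Defs
begin

text \<open>
  Let \<open>G p\<close> be the right derivative of \<open>F\<epsilon> \<epsilon> p\<close> in \<open>\<epsilon>\<close> at \<open>0\<close>. Differentiating the conservation law
  \<open>dF\<^sub>\<epsilon>(X\<^sub>\<epsilon>) = 0\<close> in \<open>\<epsilon>\<close> at a fixed point gives \<open>dG(X\<^sup>0) + dF(X\<^sup>1) = 0\<close> (\<open>initial_rate_derivative\<close>).
  Hence \<open>- G\<close> is a primitive of the integrand along the unperturbed orbit, and the integral over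
  \<open>[a, b]\<close> is \<open>G (\<gamma>h a) - G (\<gamma>h b)\<close>. As \<open>G\<close> is continuous, the integral tends to \<open>0\<close> as soon as both
  endpoints of the orbit segment tend to the same point \<open>x0\<close>. For an equilibrium \<open>\<gamma>p\<close> this happens
  along all times; otherwise \<open>\<gamma>h\<close> keeps following the periodic orbit, and the times of the hits with
  the section select the moments at which it is near \<open>x0\<close>.
  
  Two points need care. First, \<open>\<epsilon> = 0\<close> is a boundary point of the parameter range, so exchanging the
  derivative in \<open>\<epsilon>\<close> with those in space needs the symmetry of second derivatives at a corner of the
  domain; the second difference quotient over small squares, read along either side, proves it
  (\<open>symmetric_second_derivative_at_corner\<close>). All of this takes place in the one chart that defines
  \<open>mdiff\<close> at the given point, so that no two charts are ever compared.
  
  Second, for a non-constant periodic orbit the hits of \<open>\<gamma>h\<close> with a piece of the section are only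
  known to approach the whole orbit \<open>\<Gamma>p\<close>. By transversality and compactness of one period, \<open>x0\<close> is the
  only point of \<open>\<Gamma>p\<close> on the section near \<open>x0\<close> (\<open>transverse_returns_isolated\<close>), and then every sequence
  of hits close enough to \<open>x0\<close> must converge to \<open>x0\<close> (\<open>section_hits_converge\<close>).
\<close>

section \<open>Symmetry of second derivatives at a corner\<close>

text \<open>
  By the mean value theorem in the direction \<open>u\<close>, the second difference over a square of side \<open>h\<close> is
  \<open>h\<close> times the difference of \<open>f' x u\<close> between two points that differ by \<open>h *\<^sub>R v\<close> and lie at distance
  \<open>O(h)\<close> from \<open>z\<close>. Differentiability of \<open>f' x u\<close> at \<open>z\<close> alone turns this into \<open>h\<^sup>2 * A v + o(h\<^sup>2)\<close>. Only
  the quadrant \<open>s, t \<ge> 0\<close> is used, so \<open>z\<close> may be a boundary point of \<open>S\<close>.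
\<close>

lemma second_difference_tendsto:
  fixes f :: "'a::real_normed_vector \<Rightarrow> real"
  assumes "d > 0"
    and S: "\<And>s t. s \<in> {0..d} \<Longrightarrow> t \<in> {0..d} \<Longrightarrow> z + s *\<^sub>R u + t *\<^sub>R v \<in> S"
    and f: "\<And>x. x \<in> S \<Longrightarrow> (f has_derivative f' x) (at x within S)"
    and A: "((\<lambda>x. f' x u) has_derivative A) (at z within S)"
  shows "((\<lambda>h. (f (z + h *\<^sub>R u + h *\<^sub>R v) - f (z + h *\<^sub>R u) - f (z + h *\<^sub>R v) + f z) / h\<^sup>2)
    \<longlongrightarrow> A v) (at_right 0)"
proof (rule tendstoI)
  fix \<eta> :: real assume "\<eta> > 0"
  define C where "C = norm u + norm v + 1"
  have C: "C > 0" by (simp add: C_def add_nonneg_pos)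
  have linA: "linear A" using A has_derivative_linear by blast
  from \<open>\<eta> > 0\<close> C have "\<eta> / (3 * C) > 0" by simp
  then obtain d' where d': "d' > 0"
    and approx: "\<And>x. x \<in> S \<Longrightarrow> norm (x - z) < d' \<Longrightarrow>
      norm (f' x u - f' z u - A (x - z)) \<le> \<eta> / (3 * C) * norm (x - z)"
    using A unfolding has_derivative_within_alt by meson
  \<comment> \<open>Keeps the square inside \<open>S\<close> and all of its points within distance \<open>d'\<close> of \<open>z\<close>.\<close>
  define \<delta> where "\<delta> = min d (d' / C)"
  have "\<delta> > 0" using \<open>d > 0\<close> d' C by (simp add: \<delta>_def)
  moreover have "dist ((f (z + h *\<^sub>R u + h *\<^sub>R v) - f (z + h *\<^sub>R u) - f (z + h *\<^sub>R v) + f z) / h\<^sup>2) (A v) < \<eta>"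
    if h: "0 < h" "h < \<delta>" for h
  proof -
    have hd: "h < d" "h * C < d'" using h C by (auto simp: \<delta>_def field_simps)
    have der: "((\<lambda>s. f (z + s *\<^sub>R u + t *\<^sub>R v)) has_derivative
        (\<lambda>r. r * f' (z + s *\<^sub>R u + t *\<^sub>R v) u)) (at s within {0..h})"
      if "s \<in> {0..h}" "t \<in> {0..h}" for s t
    proof -
      let ?x = "z + s *\<^sub>R u + t *\<^sub>R v"
      have x: "?x \<in> S" using S that hd by auto
      have sub: "(\<lambda>s. z + s *\<^sub>R u + t *\<^sub>R v) ` {0..h} \<subseteq> S"
        using S that hd by auto
      have "((\<lambda>s. z + s *\<^sub>R u + t *\<^sub>R v) has_derivative (\<lambda>r. r *\<^sub>R u)) (at s within {0..h})"
        by (auto intro!: derivative_eq_intros)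
      from has_derivative_in_compose2[OF _ sub _ this, of f f'] f that
      have "((\<lambda>s. f (z + s *\<^sub>R u + t *\<^sub>R v)) has_derivative (\<lambda>r. f' ?x (r *\<^sub>R u))) (at s within {0..h})"
        by auto
      moreover have "f' ?x (r *\<^sub>R u) = r * f' ?x u" for r
        using linear_cmul[OF has_derivative_linear[OF f[OF x]]] by simp
      ultimately show ?thesis by simp
    qed
    define \<psi> where "\<psi> s = f (z + s *\<^sub>R u + h *\<^sub>R v) - f (z + s *\<^sub>R u + 0 *\<^sub>R v)" for s
    have "(\<psi> has_derivative (\<lambda>r. r * f' (z + s *\<^sub>R u + h *\<^sub>R v) u - r * f' (z + s *\<^sub>R u + 0 *\<^sub>R v) u))
        (at s within {0..h})" if "s \<in> {0..h}" for s
      unfolding \<psi>_def using that h by (intro has_derivative_diff der) auto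
    from mvt_simple[OF h(1) this] obtain s where s: "s \<in> {0<..<h}"
      and mvt: "\<psi> h - \<psi> 0 = h * (f' (z + s *\<^sub>R u + h *\<^sub>R v) u - f' (z + s *\<^sub>R u + 0 *\<^sub>R v) u)"
      by (auto simp: algebra_simps)
    have near: "norm (f' (z + s *\<^sub>R u + t *\<^sub>R v) u - f' z u - A (s *\<^sub>R u + t *\<^sub>R v)) \<le> \<eta> / 3 * h"
      if "t \<in> {0..h}" for t
    proof -
      let ?x = "z + s *\<^sub>R u + t *\<^sub>R v"
      have "norm (?x - z) \<le> norm (s *\<^sub>R u) + norm (t *\<^sub>R v)"
        using norm_triangle_ineq[of "s *\<^sub>R u" "t *\<^sub>R v"] by (simp add: add.assoc)
      also have "\<dots> \<le> h * norm u + h * norm v"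
        using s that by (auto intro!: add_mono mult_right_mono)
      also have "\<dots> \<le> h * C" using h by (simp add: C_def algebra_simps)
      finally have n: "norm (?x - z) \<le> h * C" .
      have "norm (f' ?x u - f' z u - A (?x - z)) \<le> \<eta> / (3 * C) * norm (?x - z)"
        using n hd s that by (intro approx S) auto
      also have "\<dots> \<le> \<eta> / (3 * C) * (h * C)"
        using n \<open>\<eta> > 0\<close> C by (intro mult_left_mono) auto
      also have "\<dots> = \<eta> / 3 * h" using C by simp
      finally show ?thesis by (simp add: add.assoc)
    qed
    \<comment> \<open>The two remainders add up to at most \<open>2 / 3 * \<eta> * h\<close>; the factor \<open>3\<close> makes the bound strict.\<close>
    define q where "q = f' (z + s *\<^sub>R u + h *\<^sub>R v) u - f' (z + s *\<^sub>R u + 0 *\<^sub>R v) u"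
    have "A (s *\<^sub>R u + h *\<^sub>R v) = A (s *\<^sub>R u) + h * A v"
      by (simp add: linear_add[OF linA] linear_cmul[OF linA])
    then have "q - h * A v = (f' (z + s *\<^sub>R u + h *\<^sub>R v) u - f' z u - A (s *\<^sub>R u + h *\<^sub>R v))
        - (f' (z + s *\<^sub>R u + 0 *\<^sub>R v) u - f' z u - A (s *\<^sub>R u + 0 *\<^sub>R v))"
      by (simp add: q_def)
    also have "\<bar>\<dots>\<bar> \<le> \<eta> / 3 * h + \<eta> / 3 * h"
      using near[of h] near[of 0] h unfolding real_norm_def
      by (intro order_trans[OF abs_triangle_ineq4[of "_ - _ - _" "_ - _ - _"] add_mono]) auto
    finally have "\<bar>q - h * A v\<bar> \<le> 2 * (\<eta> / 3 * h)" by simp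
    also have "\<dots> < \<eta> * h" using \<open>\<eta> > 0\<close> h by simp
    finally have "\<bar>q - h * A v\<bar> / h < \<eta>" using h by (simp add: field_simps)
    moreover have "f (z + h *\<^sub>R u + h *\<^sub>R v) - f (z + h *\<^sub>R u) - f (z + h *\<^sub>R v) + f z = h * q"
      using mvt by (simp add: \<psi>_def q_def)
    moreover have "\<bar>h * q / h\<^sup>2 - A v\<bar> = \<bar>q - h * A v\<bar> / h"
    proof -
      have "h * q / h\<^sup>2 - A v = (q - h * A v) / h" using h by (simp add: field_simps power2_eq_square)
      then show ?thesis using h by simp
    qed
    ultimately show ?thesis by (simp add: dist_real_def)
  qed
  ultimately show "\<forall>\<^sub>F h in at_right 0. dist ((f (z + h *\<^sub>R u + h *\<^sub>R v) - f (z + h *\<^sub>R u)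
      - f (z + h *\<^sub>R v) + f z) / h\<^sup>2) (A v) < \<eta>"
    unfolding eventually_at_right_field by (intro exI[of _ \<delta>]) auto
qed

text \<open>
  The second difference does not change when \<open>u\<close> and \<open>v\<close> are exchanged, so its two limits agree.
\<close>

lemma symmetric_second_derivative_at_corner:
  fixes f :: "'a::real_normed_vector \<Rightarrow> real"
  assumes d: "d > 0"
    and S: "\<And>s t. s \<in> {0..d} \<Longrightarrow> t \<in> {0..d} \<Longrightarrow> z + s *\<^sub>R u + t *\<^sub>R v \<in> S"
    and f: "\<And>x. x \<in> S \<Longrightarrow> (f has_derivative f' x) (at x within S)"
    and A: "((\<lambda>x. f' x u) has_derivative A) (at z within S)"
    and B: "((\<lambda>x. f' x v) has_derivative B) (at z within S)"
  shows "A v = B u"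
proof -
  have S': "z + s *\<^sub>R v + t *\<^sub>R u \<in> S" if "s \<in> {0..d}" "t \<in> {0..d}" for s t
    using S[OF that(2,1)] by (simp add: add_ac)
  have "(\<lambda>h. (f (z + h *\<^sub>R v + h *\<^sub>R u) - f (z + h *\<^sub>R v) - f (z + h *\<^sub>R u) + f z) / h\<^sup>2) =
      (\<lambda>h. (f (z + h *\<^sub>R u + h *\<^sub>R v) - f (z + h *\<^sub>R u) - f (z + h *\<^sub>R v) + f z) / h\<^sup>2)"
    by (simp add: algebra_simps)
  with second_difference_tendsto[OF d S' f B] second_difference_tendsto[OF d S f A]
  show ?thesis using tendsto_unique[OF trivial_limit_at_right_real] by fastforce
qed

section \<open>Differentiating a conservation law in the parameter\<close>

lemma at_within_Ico_at_right: "(0::real) < e \<Longrightarrow> at 0 within {0..<e} = at_right 0"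
  by (rule at_within_nhd[where S="{..<e}"]) auto

lemma has_vector_derivative_at_within_quotient:
  "(f has_vector_derivative w) (at (0::real) within T) \<longleftrightarrow>
    ((\<lambda>t. (f t - f 0) /\<^sub>R t) \<longlongrightarrow> w) (at 0 within T)"
proof -
  have "(f has_vector_derivative w) (at 0 within T) \<longleftrightarrow>
     ((\<lambda>t. norm (f t - f 0 - t *\<^sub>R w) / norm t) \<longlongrightarrow> 0) (at 0 within T)"
    by (simp add: has_vector_derivative_def has_derivative_iff_norm bounded_linear_scaleR_left)
  also have "(\<lambda>t. norm (f t - f 0 - t *\<^sub>R w) / norm t) = (\<lambda>t. norm ((f t - f 0 - t *\<^sub>R w) /\<^sub>R t))"
    by (simp add: divide_inverse_commute)
  also have "(\<dots> \<longlongrightarrow> 0) (at 0 within T) \<longleftrightarrow>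
     ((\<lambda>t. (f t - f 0) /\<^sub>R t - w) \<longlongrightarrow> 0) (at 0 within T)"
    unfolding tendsto_norm_zero_iff
    by (rule tendsto_cong) (auto simp: eventually_at_filter scaleR_diff_right)
  also have "\<dots> \<longleftrightarrow> ((\<lambda>t. (f t - f 0) /\<^sub>R t) \<longlongrightarrow> w) (at 0 within T)"
    by (rule LIM_zero_iff)
  finally show ?thesis .
qed

text \<open>
  The coordinate form of \<open>dG(X\<^sup>0) + dF(X\<^sup>1) = 0\<close>. With \<open>D\<close> the total derivative of \<open>\<Phi>\<close>, the
  conservation law reads \<open>D (y, \<epsilon>) (\<xi> \<epsilon>, 0) = 0\<close>. Splitting \<open>\<xi> \<epsilon> = \<xi> 0 + (\<xi> \<epsilon> - \<xi> 0)\<close> and dividing by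
  \<open>\<epsilon>\<close> yields a difference quotient of \<open>D (y, \<epsilon>) (\<xi> 0, 0)\<close>, which tends to a mixed second derivative,
  and a term tending to \<open>D (y, 0) (w, 0)\<close>. The symmetry at the corner \<open>(y, 0)\<close> identifies the mixed
  derivative with the derivative of the initial rate of change in the direction \<open>\<xi> 0\<close>.
\<close>

lemma first_order_conservation:
  fixes \<Phi> :: "'m::euclidean_space \<times> real \<Rightarrow> real" and \<xi> :: "real \<Rightarrow> 'm"
  assumes U: "open U" "y \<in> U" and e: "e > 0"
    and \<Phi>: "Ck_on 2 \<Phi> (U \<times> {0..<e})"
    and \<xi>: "(\<xi> has_vector_derivative w) (at_right 0)"
    and conserved: "\<And>\<epsilon>. \<epsilon> \<in> {0..<e} \<Longrightarrow> frechet_derivative (\<lambda>x. \<Phi> (x, \<epsilon>)) (at y) (\<xi> \<epsilon>) = 0"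
  shows "\<exists>L. ((\<lambda>x. vector_derivative (\<lambda>\<epsilon>. \<Phi> (x, \<epsilon>)) (at_right 0)) has_derivative L) (at y) \<and>
    L (\<xi> 0) = - frechet_derivative (\<lambda>x. \<Phi> (x, 0)) (at y) w"
proof -
  define S where "S = U \<times> {0..<e}"
  define D where "D z = frechet_derivative \<Phi> (at z within S)" for z
  have "\<Phi> differentiable_on S" and "(\<lambda>z. D z v) differentiable_on S" for v
    using \<Phi> unfolding D_def S_def numeral_2_eq_2 Ck_on.simps by blast+
  then have D: "(\<Phi> has_derivative D z) (at z within S)"
    and D2: "\<exists>E. ((\<lambda>z. D z v) has_derivative E) (at z within S)" if "z \<in> S" for v z
    using that unfolding D_def differentiable_on_def differentiable_def
    by (simp_all add: frechet_derivative_works[symmetric] differentiable_def)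
  have slice: "((\<lambda>x. g (x, \<epsilon>)) has_derivative (\<lambda>v. E (v, 0))) (at x)"
    if g: "(g has_derivative E) (at (x, \<epsilon>) within S)" and x: "x \<in> U" "\<epsilon> \<in> {0..<e}" 
    for g :: "_ \<Rightarrow> real" and E x \<epsilon>
  proof -
    have "((\<lambda>x. (x, \<epsilon>)) has_derivative (\<lambda>v. (v, 0))) (at x within U)"
      by (auto intro!: derivative_eq_intros)
    moreover have "(\<lambda>x. (x, \<epsilon>)) ` U \<subseteq> S" using x by (auto simp: S_def)
    then have "(g has_derivative E) (at ((\<lambda>x. (x, \<epsilon>)) x) within (\<lambda>x. (x, \<epsilon>)) ` U)"
      using has_derivative_subset[OF g] by simp
    ultimately have "((\<lambda>x. g (x, \<epsilon>)) has_derivative (\<lambda>v. E (v, 0))) (at x within U)"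
      by (rule has_derivative_in_compose)
    then show ?thesis using at_within_open[OF x(1) U(1)] by simp
  qed
  have fiber: "((\<lambda>\<epsilon>. g (x, \<epsilon>)) has_vector_derivative E (0, 1)) (at_right 0)"
    if g: "(g has_derivative E) (at (x, 0) within S)" and x: "x \<in> U" for g :: "_ \<Rightarrow> real" and E x
  proof -
    have "((\<lambda>\<epsilon>. (x, \<epsilon>)) has_derivative (\<lambda>r. (0, r))) (at 0 within {0..<e})"
      by (auto intro!: derivative_eq_intros)
    moreover have "(\<lambda>\<epsilon>. (x, \<epsilon>)) ` {0..<e} \<subseteq> S" using x by (auto simp: S_def)
    then have "(g has_derivative E) (at ((\<lambda>\<epsilon>. (x, \<epsilon>)) 0) within (\<lambda>\<epsilon>. (x, \<epsilon>)) ` {0..<e})"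
      using has_derivative_subset[OF g] by simp
    ultimately have "((\<lambda>\<epsilon>. g (x, \<epsilon>)) has_derivative (\<lambda>r. E (0, r))) (at 0 within {0..<e})"
      by (rule has_derivative_in_compose)
    moreover have "(\<lambda>r. E (0, r)) = (\<lambda>r. r *\<^sub>R E (0, 1))"
    proof
      show "E (0, r) = r *\<^sub>R E (0, 1)" for r
        using linear_cmul[OF has_derivative_linear[OF g], of r "(0,1)"] by simp
    qed
    ultimately show ?thesis
      unfolding has_vector_derivative_def at_within_Ico_at_right[OF e] by simp
  qed
  have y0: "(y, 0) \<in> S" using U e by (auto simp: S_def)
  have horizontal: "frechet_derivative (\<lambda>x. \<Phi> (x, \<epsilon>)) (at y) v = D (y, \<epsilon>) (v, 0)"
    if "\<epsilon> \<in> {0..<e}" for \<epsilon> v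
  proof -
    have "(y, \<epsilon>) \<in> S" using that U by (auto simp: S_def)
    from fun_cong[OF frechet_derivative_at[OF slice[OF D[OF this] U(2) that]], of v]
    show ?thesis by (rule sym)
  qed
  have vertical: "vector_derivative (\<lambda>\<epsilon>. \<Phi> (x, \<epsilon>)) (at_right 0) = D (x, 0) (0, 1)"
    if "x \<in> U" for x
    using that e by (intro vector_derivative_within fiber D) (auto simp: S_def)
  obtain B where B: "((\<lambda>z. D z (0, 1)) has_derivative B) (at (y, 0) within S)"
    using D2[OF y0] by blast
  obtain E where E: "((\<lambda>z. D z (\<xi> 0, 0)) has_derivative E) (at (y, 0) within S)"
    using D2[OF y0] by blast
  have "((\<lambda>x. D (x, 0) (0, 1)) has_derivative (\<lambda>v. B (v, 0))) (at y)"
    using slice[OF B U(2)] e by simp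
  then have G: "((\<lambda>x. vector_derivative (\<lambda>\<epsilon>. \<Phi> (x, \<epsilon>)) (at_right 0)) has_derivative
      (\<lambda>v. B (v, 0))) (at y)"
    by (rule has_derivative_transform_within_open[OF _ U]) (simp add: vertical)
  have EB: "E (0, 1) = B (\<xi> 0, 0)"
  proof -
    obtain r where r: "r > 0" "ball y r \<subseteq> U" using U open_contains_ball by blast
    \<comment> \<open>Small enough for the square spanned by \<open>(\<xi> 0, 0)\<close> and \<open>(0, 1)\<close> to stay in \<open>S\<close>.\<close>
    define d where "d = min (e / 2) (r / (norm (\<xi> 0) + 1))"
    have pos: "norm (\<xi> 0) + 1 > 0" by (simp add: add_nonneg_pos)
    have d: "d > 0" using r e pos by (simp add: d_def)
    have "(y, 0) + s *\<^sub>R (\<xi> 0, 0) + t *\<^sub>R (0, 1) \<in> S" if "s \<in> {0..d}" "t \<in> {0..d}" for s t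
    proof -
      have "s \<le> r / (norm (\<xi> 0) + 1)" using that by (simp add: d_def)
      then have "s * (norm (\<xi> 0) + 1) \<le> r" using pos by (simp add: field_simps)
      moreover have "s * norm (\<xi> 0) < r"
      proof (cases "s = 0")
        case False
        then have "s * norm (\<xi> 0) < s * (norm (\<xi> 0) + 1)" using that by simp
        then show ?thesis using calculation by linarith
      qed (use r in auto)
      ultimately have "y + s *\<^sub>R \<xi> 0 \<in> U"
        using r(2) that by (auto simp: subset_iff dist_norm)
      moreover have "t < e" using that e by (auto simp: d_def)
      ultimately show ?thesis using that by (simp add: S_def)
    qed
    from symmetric_second_derivative_at_corner[OF d this D E B] show ?thesis .
  qed
  have quot: "((\<lambda>\<epsilon>. (\<xi> \<epsilon> - \<xi> 0) /\<^sub>R \<epsilon>) \<longlongrightarrow> w) (at_right 0)"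
    using \<xi> by (simp add: has_vector_derivative_at_within_quotient)
  have lin: "linear (D z)" if "z \<in> S" for z
    using D[OF that] has_derivative_linear by blast
  have cont: "((\<lambda>\<epsilon>. D (y, \<epsilon>) v) \<longlongrightarrow> D (y, 0) v) (at_right 0)" for v
  proof -
    obtain E' where E': "((\<lambda>z. D z v) has_derivative E') (at (y, 0) within S)"
      using D2[OF y0] by blast
    from has_vector_derivative_continuous[OF fiber[OF E' U(2)]] show ?thesis
      by (simp add: continuous_within)
  qed
  \<comment> \<open>Continuity in \<open>\<epsilon>\<close> is available for one fixed direction at a time; a basis
    expansion passes to the limit when the direction varies with \<open>\<epsilon>\<close> as well.\<close>
  have expand: "D z (v, 0) = (\<Sum>b\<in>Basis. (v \<bullet> b) * D z (b, 0))" if "z \<in> S" for z v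
  proof -
    have "linear (\<lambda>v. D z (v, 0))"
      using linear_compose[OF _ lin[OF that], of "\<lambda>v. (v, 0)"]
      by (simp add: o_def linear_iff)
    from linear_sum[OF this, of "\<lambda>b. (v \<bullet> b) *\<^sub>R b" Basis] linear_cmul[OF this]
    have "D z (\<Sum>b\<in>Basis. (v \<bullet> b) *\<^sub>R b, 0) = (\<Sum>b\<in>Basis. (v \<bullet> b) * D z (b, 0))"
      by simp
    then show ?thesis by (simp add: euclidean_representation)
  qed
  have lim1: "((\<lambda>\<epsilon>. D (y, \<epsilon>) ((\<xi> \<epsilon> - \<xi> 0) /\<^sub>R \<epsilon>, 0)) \<longlongrightarrow> D (y, 0) (w, 0)) (at_right 0)"
  proof -
    have "((\<lambda>\<epsilon>. \<Sum>b\<in>Basis. (((\<xi> \<epsilon> - \<xi> 0) /\<^sub>R \<epsilon>) \<bullet> b) * D (y, \<epsilon>) (b, 0)) \<longlongrightarrow>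
        (\<Sum>b\<in>Basis. (w \<bullet> b) * D (y, 0) (b, 0))) (at_right 0)"
      by (rule tendsto_sum) (rule tendsto_mult[OF tendsto_inner[OF quot tendsto_const] cont])
    then have "((\<lambda>\<epsilon>. \<Sum>b\<in>Basis. (((\<xi> \<epsilon> - \<xi> 0) /\<^sub>R \<epsilon>) \<bullet> b) * D (y, \<epsilon>) (b, 0)) \<longlongrightarrow>
        D (y, 0) (w, 0)) (at_right 0)"
      unfolding expand[OF y0, of w, symmetric] .
    moreover have "\<forall>\<^sub>F \<epsilon> in at_right 0. (\<Sum>b\<in>Basis. (((\<xi> \<epsilon> - \<xi> 0) /\<^sub>R \<epsilon>) \<bullet> b) * D (y, \<epsilon>) (b, 0)) =
        D (y, \<epsilon>) ((\<xi> \<epsilon> - \<xi> 0) /\<^sub>R \<epsilon>, 0)"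
      unfolding eventually_at_right_field using e U
      by (intro exI[of _ e] conjI allI impI expand[symmetric]) (auto simp: S_def)
    ultimately show ?thesis by (rule Lim_transform_eventually)
  qed
  have lim2: "((\<lambda>\<epsilon>. (D (y, \<epsilon>) (\<xi> 0, 0) - D (y, 0) (\<xi> 0, 0)) / \<epsilon>) \<longlongrightarrow> E (0, 1)) (at_right 0)"
    using fiber[OF E U(2)] by (simp add: has_vector_derivative_at_within_quotient divide_inverse_commute)
  have "\<forall>\<^sub>F \<epsilon> in at_right 0. D (y, \<epsilon>) ((\<xi> \<epsilon> - \<xi> 0) /\<^sub>R \<epsilon>, 0)
      = - ((D (y, \<epsilon>) (\<xi> 0, 0) - D (y, 0) (\<xi> 0, 0)) / \<epsilon>)"
  proof -
    have "D (y, \<epsilon>) ((\<xi> \<epsilon> - \<xi> 0) /\<^sub>R \<epsilon>, 0) = - ((D (y, \<epsilon>) (\<xi> 0, 0) - D (y, 0) (\<xi> 0, 0)) / \<epsilon>)"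
      if "0 < \<epsilon>" "\<epsilon> < e" for \<epsilon>
    proof -
      have l: "linear (D (y, \<epsilon>))" using lin that U by (simp add: S_def)
      have "((\<xi> \<epsilon> - \<xi> 0) /\<^sub>R \<epsilon>, 0) = inverse \<epsilon> *\<^sub>R ((\<xi> \<epsilon>, 0) - (\<xi> 0, 0 :: real))" by simp
      then have "D (y, \<epsilon>) ((\<xi> \<epsilon> - \<xi> 0) /\<^sub>R \<epsilon>, 0) = (D (y, \<epsilon>) (\<xi> \<epsilon>, 0) - D (y, \<epsilon>) (\<xi> 0, 0)) / \<epsilon>"
        by (simp only: linear_cmul[OF l] linear_diff[OF l]) (simp add: divide_inverse)
      moreover have "D (y, \<epsilon>) (\<xi> \<epsilon>, 0) = 0" "D (y, 0) (\<xi> 0, 0) = 0"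
        using conserved[of \<epsilon>] conserved[of 0] horizontal that e by auto
      ultimately show ?thesis by simp
    qed
    then show ?thesis unfolding eventually_at_right_field using e by blast
  qed
  from Lim_transform_eventually[OF lim1 this] tendsto_minus[OF lim2]
  have "D (y, 0) (w, 0) = - E (0, 1)"
    by (rule tendsto_unique[OF trivial_limit_at_right_real])
  with EB G horizontal[of 0 w] e show ?thesis
    by (intro exI[of _ "\<lambda>v. B (v, 0)"]) simp
qed

text \<open>
  An expansion for \<open>\<epsilon> \<rightarrow> 0\<close> from the right says nothing about the value at \<open>0\<close> itself; continuity
  supplies it, and then the coefficient of \<open>\<epsilon>\<close> is the right derivative.
\<close>

lemma first_order_expansion_at_right:
  fixes g :: "real \<Rightarrow> 'b::real_normed_vector"
  assumes O: "(\<lambda>\<epsilon>. norm (g \<epsilon> - (a + \<epsilon> *\<^sub>R b))) \<in> O[at_right 0](\<lambda>\<epsilon>. \<epsilon>\<^sup>2)"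
    and cont: "(g \<longlongrightarrow> g 0) (at_right 0)"
  shows "g 0 = a" "(g has_vector_derivative b) (at_right 0)"
proof -
  obtain C where C: "\<forall>\<^sub>F \<epsilon> in at_right 0. norm (g \<epsilon> - (a + \<epsilon> *\<^sub>R b)) \<le> C * \<epsilon>\<^sup>2"
    using O by (auto elim!: landau_o.bigE)
  have pos: "\<forall>\<^sub>F \<epsilon> in at_right (0::real). \<epsilon> > 0" by (rule eventually_at_right_less)
  have id: "((\<lambda>\<epsilon>. \<epsilon>) \<longlongrightarrow> (0::real)) (at_right 0)" by (rule tendsto_ident_at)
  have "((\<lambda>\<epsilon>. C * \<epsilon>\<^sup>2) \<longlongrightarrow> C * 0\<^sup>2) (at_right 0)" by (intro tendsto_intros)
  then have "((\<lambda>\<epsilon>. g \<epsilon> - (a + \<epsilon> *\<^sub>R b)) \<longlongrightarrow> 0) (at_right 0)"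
    using Lim_null_comparison[OF C] by simp
  moreover have "((\<lambda>\<epsilon>. a + \<epsilon> *\<^sub>R b) \<longlongrightarrow> a + 0 *\<^sub>R b) (at_right 0)"
    by (intro tendsto_intros)
  ultimately have "((\<lambda>\<epsilon>. (g \<epsilon> - (a + \<epsilon> *\<^sub>R b)) + (a + \<epsilon> *\<^sub>R b)) \<longlongrightarrow> 0 + (a + 0 *\<^sub>R b)) (at_right 0)"
    by (rule tendsto_add)
  then have "(g \<longlongrightarrow> a) (at_right 0)" by simp
  with cont show g0: "g 0 = a"
    by (intro tendsto_unique[OF trivial_limit_at_right_real])
  have "\<forall>\<^sub>F \<epsilon> in at_right 0. norm ((g \<epsilon> - g 0) /\<^sub>R \<epsilon> - b) \<le> C * \<epsilon>"
    using C pos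
  proof eventually_elim
    case (elim \<epsilon>)
    have "(g \<epsilon> - g 0) /\<^sub>R \<epsilon> - b = (g \<epsilon> - (a + \<epsilon> *\<^sub>R b)) /\<^sub>R \<epsilon>"
      using elim(2) g0 by (simp add: algebra_simps)
    then have "norm ((g \<epsilon> - g 0) /\<^sub>R \<epsilon> - b) = norm (g \<epsilon> - (a + \<epsilon> *\<^sub>R b)) / \<epsilon>"
      using elim(2) by (simp add: divide_inverse_commute)
    also have "\<dots> \<le> C * \<epsilon>\<^sup>2 / \<epsilon>" using elim by (intro divide_right_mono) auto
    also have "\<dots> = C * \<epsilon>" using elim(2) by (simp add: power2_eq_square)
    finally show ?case .
  qed
  moreover have "((\<lambda>\<epsilon>. C * \<epsilon>) \<longlongrightarrow> 0) (at_right 0)"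
    using tendsto_mult[OF tendsto_const[of C] id] by simp
  ultimately have "((\<lambda>\<epsilon>. (g \<epsilon> - g 0) /\<^sub>R \<epsilon> - b) \<longlongrightarrow> 0) (at_right 0)"
    by (rule Lim_null_comparison)
  then show "(g has_vector_derivative b) (at_right 0)"
    unfolding has_vector_derivative_at_within_quotient by (rule LIM_zero_cancel)
qed

section \<open>Charts and curves\<close>

lemma chart_inv_chart:
  assumes c: "is_chart M c" and "p \<in> fst c"
  shows "chart_inv c (snd c p) = p"
proof -
  have "inj_on (snd c) (topspace (subtopology M (fst c)))"
    using c homeomorphic_imp_injective_map unfolding is_chart_def by blast
  moreover have "topspace (subtopology M (fst c)) = fst c"
    using c openin_subset[of M "fst c"] by (auto simp: is_chart_def)
  ultimately show ?thesis using assms(2) by (simp add: chart_inv_def)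
qed

lemma open_chart_image:
  assumes c: "is_chart M c" and N: "openin M N"
  shows "open (snd c ` (fst c \<inter> N))"
proof -
  have "open_map (subtopology M (fst c)) (top_of_set (snd c ` fst c)) (snd c)"
    using c by (simp add: is_chart_def homeomorphic_imp_open_map)
  moreover have "openin (subtopology M (fst c)) (fst c \<inter> N)"
    using N by (auto simp: openin_subtopology)
  ultimately have "openin (top_of_set (snd c ` fst c)) (snd c ` (fst c \<inter> N))"
    unfolding open_map_def by blast
  then show ?thesis
    using c openin_open_trans unfolding is_chart_def by blast
qed

lemma continuous_map_chart_inv:
  assumes c: "is_chart M c"
  shows "continuous_map (top_of_set (snd c ` fst c)) M (chart_inv c)"
  unfolding continuous_map_def
proof (intro conjI allI impI)
  show "chart_inv c \<in> topspace (top_of_set (snd c ` fst c)) \<rightarrow> topspace M"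
    using c chart_inv_chart[OF c] openin_subset[of M "fst c"] by (auto simp: is_chart_def)
  fix U assume U: "openin M U"
  have "{y \<in> topspace (top_of_set (snd c ` fst c)). chart_inv c y \<in> U} = snd c ` (fst c \<inter> U)"
    using chart_inv_chart[OF c] by auto
  moreover have "openin (top_of_set (snd c ` fst c)) (snd c ` (fst c \<inter> U))"
    using open_chart_image[OF c U] by (intro open_subset) auto
  ultimately show "openin (top_of_set (snd c ` fst c))
      {y \<in> topspace (top_of_set (snd c ` fst c)). chart_inv c y \<in> U}"
    by simp
qed

lemma openin_chart_preimage:
  assumes c: "is_chart M c" and B: "open B"
  shows "openin M {q \<in> fst c. snd c q \<in> B}"
proof -
  have fc: "openin M (fst c)" using c by (simp add: is_chart_def)
  have "continuous_map (subtopology M (fst c)) (top_of_set (snd c ` fst c)) (snd c)"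
    using c by (simp add: is_chart_def homeomorphic_imp_continuous_map)
  then have "continuous_map (subtopology M (fst c)) euclidean (snd c)"
    using continuous_map_into_fulltopology by blast
  from openin_continuous_map_preimage[OF this, of B] B
  have "openin (subtopology M (fst c)) {q \<in> topspace M \<inter> fst c. snd c q \<in> B}"
    by simp
  moreover have "topspace M \<inter> fst c = fst c" using openin_subset[OF fc] by blast
  ultimately show ?thesis using openin_trans_full[OF _ fc] by simp
qed

lemma chart_at_covers:
  assumes "oriented_Ck_atlas k M A" "p \<in> topspace M"
  shows "chart_at A p \<in> A" "p \<in> fst (chart_at A p)" "is_chart M (chart_at A p)"
proof -
  have "\<exists>c. c \<in> A \<and> p \<in> fst c" using assms unfolding oriented_Ck_atlas_def by blast
  from someI_ex[OF this] show *: "chart_at A p \<in> A" "p \<in> fst (chart_at A p)"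
    by (auto simp: chart_at_def)
  then show "is_chart M (chart_at A p)" using assms unfolding oriented_Ck_atlas_def by blast
qed

lemma eventually_curve_in:
  assumes "continuous_map euclideanreal M \<gamma>" "openin M N" "\<gamma> t \<in> N"
  shows "\<forall>\<^sub>F s in nhds t. \<gamma> s \<in> N"
proof -
  have "open {s. \<gamma> s \<in> N}"
    using openin_continuous_map_preimage[OF assms(1,2)] by simp
  then show ?thesis using assms(3) unfolding eventually_nhds by blast
qed

lemma has_real_derivative_along_curve:
  fixes H :: "'a \<Rightarrow> real" and c :: "('a, 'n::finite) chart"
  assumes \<gamma>: "integral_curve M A X \<gamma>" and c: "c \<in> A" "is_chart M c" "\<gamma> t \<in> fst c"
    and H: "((\<lambda>y. H (chart_inv c y)) has_derivative L) (at (snd c (\<gamma> t)))"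
  shows "((\<lambda>s. H (\<gamma> s)) has_real_derivative L (X (\<gamma> t) c)) (at t)"
proof -
  have "((\<lambda>s. snd c (\<gamma> s)) has_vector_derivative X (\<gamma> t) c) (at t)"
    using \<gamma> c unfolding integral_curve_def o_def by blast
  from has_derivative_compose[OF this[unfolded has_vector_derivative_def] H]
  have "((\<lambda>s. H (chart_inv c (snd c (\<gamma> s)))) has_derivative (\<lambda>r. L (r *\<^sub>R X (\<gamma> t) c))) (at t)" .
  also have "(\<lambda>r. L (r *\<^sub>R X (\<gamma> t) c)) = (*) (L (X (\<gamma> t) c))"
    using linear_cmul[OF has_derivative_linear[OF H]] by (auto simp: mult.commute)
  finally have der: "((\<lambda>s. H (chart_inv c (snd c (\<gamma> s)))) has_real_derivative L (X (\<gamma> t) c)) (at t)"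
    by (simp add: has_field_derivative_def)
  have "\<forall>\<^sub>F s in nhds t. \<gamma> s \<in> fst c"
    using \<gamma> c by (intro eventually_curve_in) (auto simp: integral_curve_def is_chart_def)
  then have "\<forall>\<^sub>F s in nhds t. H (chart_inv c (snd c (\<gamma> s))) = H (\<gamma> s)"
    by eventually_elim (simp add: chart_inv_chart[OF c(2)])
  from DERIV_cong_ev[OF refl this refl] der show ?thesis by simp
qed

lemma tendsto_along_limitin:
  fixes H :: "'a \<Rightarrow> real" and c :: "('a, 'n::finite) chart"
  assumes lim: "limitin M h p \<F>" and c: "is_chart M c" "p \<in> fst c"
    and H: "isCont (\<lambda>y. H (chart_inv c y)) (snd c p)"
  shows "((\<lambda>s. H (h s)) \<longlongrightarrow> H p) \<F>"
proof (rule topological_tendstoI)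
  fix B assume B: "open B" "H p \<in> B"
  then have "open B \<and> H (chart_inv c (snd c p)) \<in> B" using chart_inv_chart[OF c] by simp
  from H[unfolded continuous_at_open, THEN spec, THEN mp, OF this]
  obtain Y where Y: "open Y" "snd c p \<in> Y" "\<And>y. y \<in> Y \<Longrightarrow> H (chart_inv c y) \<in> B"
    by auto
  have "\<forall>\<^sub>F s in \<F>. h s \<in> {q \<in> fst c. snd c q \<in> Y}"
    using lim[unfolded limitin_def, THEN conjunct2, rule_format, of "{q \<in> fst c. snd c q \<in> Y}"]
      openin_chart_preimage[OF c(1) Y(1)] c(2) Y(2) by blast
  then show "\<forall>\<^sub>F s in \<F>. H (h s) \<in> B"
  proof eventually_elim
    case (elim s)
    then show ?case using Y(3)[of "snd c (h s)"] chart_inv_chart[OF c(1)] by simp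
  qed
qed

section \<open>The initial rate of change of the first integrals\<close>

text \<open>
  The function \<open>G\<close> of the opening remarks. It is defined without charts, so that it is a single
  function near the whole homoclinic orbit, and it is a one-sided derivative because the parameter is
  nonnegative.
\<close>

definition initial_rate :: "(real \<Rightarrow> 'a \<Rightarrow> real) \<Rightarrow> 'a \<Rightarrow> real" where
  "initial_rate F\<epsilon> p = vector_derivative (\<lambda>\<epsilon>. F\<epsilon> \<epsilon> p) (at_right 0)"

text \<open>
  In coordinates this is \<open>first_order_conservation\<close> applied to \<open>\<xi> \<epsilon> = X \<epsilon> p c\<close>, whose value and right
  derivative at \<open>0\<close> the expansion of the vector fields identifies as \<open>X0 p c\<close> and \<open>X1 p c\<close>.
\<close>

lemma initial_rate_derivative:
  fixes A :: "('a, 'n::finite) chart set"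
  assumes atlas: "oriented_Ck_atlas k M A"
    and e0: "e0 > 0"
    and X: "Ck_vector_field_family 2 M A e0 X"
    and expansion: "first_order_expansion A X X0 X1"
    and N: "openin M N" and N': "openin M N'"
    and F\<epsilon>: "Ck_function_family 2 A N' e0 F\<epsilon>" "Ck_function 3 A N' (F\<epsilon> 0)"
    and conserved: "\<And>\<epsilon>. \<epsilon> \<in> {0..<e0} \<Longrightarrow> first_integral A N' (X \<epsilon>) (F\<epsilon> \<epsilon>)"
    and F0: "\<And>p. p \<in> N \<inter> N' \<Longrightarrow> F\<epsilon> 0 p = F p"
    and p: "p \<in> N \<inter> N'"
    and c_def: "c = chart_at A p"
  shows "\<exists>L. ((\<lambda>y. initial_rate F\<epsilon> (chart_inv c y)) has_derivative L) (at (snd c p)) \<and>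
    L (X0 p c) = - mdiff A F p (X1 p)"
proof -
  have "p \<in> topspace M" using p N openin_subset by fastforce
  note c = chart_at_covers[OF atlas this, folded c_def]
  define y where "y = snd c p"
  define U where "U = snd c ` (fst c \<inter> N')"
  define \<Phi> where "\<Phi> = (\<lambda>(y, \<epsilon>). F\<epsilon> \<epsilon> (chart_inv c y))"
  have p_eq: "chart_inv c y = p" using chart_inv_chart[OF c(3,2)] by (simp add: y_def)
  have U: "open U" "y \<in> U"
    using open_chart_image[OF c(3) N'] c p by (auto simp: U_def y_def)
  have \<Phi>: "Ck_on 2 \<Phi> (U \<times> {0..<e0})"
    using F\<epsilon>(1) c(1) unfolding Ck_function_family_def U_def \<Phi>_def by blast
  have "continuous_on (snd c ` fst c \<times> {0..<e0}) (\<lambda>(y, \<epsilon>). X \<epsilon> (chart_inv c y) c)"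
    using X c(1) unfolding Ck_vector_field_family_def numeral_2_eq_2 Ck_on.simps
    by (blast intro: differentiable_imp_continuous_on)
  then have "continuous_on {0..<e0} (\<lambda>\<epsilon>. case (y, \<epsilon>) of (y, \<epsilon>) \<Rightarrow> X \<epsilon> (chart_inv c y) c)"
    by (rule continuous_on_compose2) (use c in \<open>auto simp: y_def intro!: continuous_intros\<close>)
  then have "((\<lambda>\<epsilon>. X \<epsilon> p c) \<longlongrightarrow> X 0 p c) (at_right 0)"
    using e0 p_eq bspec[of "{0..<e0}" _ 0] by (simp add: continuous_on_def flip: at_within_Ico_at_right[OF e0])
  moreover have "(\<lambda>\<epsilon>. norm (X \<epsilon> p c - (X0 p c + \<epsilon> *\<^sub>R X1 p c))) \<in> O[at_right 0](\<lambda>\<epsilon>. \<epsilon>\<^sup>2)"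
    using expansion c unfolding first_order_expansion_def by blast
  ultimately have \<xi>: "X 0 p c = X0 p c"
      "((\<lambda>\<epsilon>. X \<epsilon> p c) has_vector_derivative X1 p c) (at_right 0)"
    using first_order_expansion_at_right[of "\<lambda>\<epsilon>. X \<epsilon> p c"] by blast+
  have mdiff: "mdiff A f p v = frechet_derivative (\<lambda>x. f (chart_inv c x)) (at y) (v c)" for f v
    by (simp add: mdiff_def Let_def c_def y_def o_def)
  have "frechet_derivative (\<lambda>x. \<Phi> (x, \<epsilon>)) (at y) (X \<epsilon> p c) = 0" if "\<epsilon> \<in> {0..<e0}" for \<epsilon>
  proof -
    have "mdiff A (F\<epsilon> \<epsilon>) p (X \<epsilon> p) = 0"
      using conserved[OF that] p unfolding first_integral_def by blast
    then show ?thesis by (simp add: mdiff \<Phi>_def)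
  qed
  from first_order_conservation[OF U e0 \<Phi> \<xi>(2) this] \<xi>(1)
  obtain L where L: "((\<lambda>x. vector_derivative (\<lambda>\<epsilon>. \<Phi> (x, \<epsilon>)) (at_right 0)) has_derivative L) (at y)"
    "L (X0 p c) = - frechet_derivative (\<lambda>x. \<Phi> (x, 0)) (at y) (X1 p c)"
    by auto
  have "(\<lambda>x. F\<epsilon> 0 (chart_inv c x)) differentiable_on U"
    using F\<epsilon>(2) c(1) unfolding Ck_function_def numeral_3_eq_3 Ck_on.simps U_def o_def by blast
  then have "(\<lambda>x. \<Phi> (x, 0)) differentiable (at y)"
    using U by (simp add: \<Phi>_def differentiable_on_eq_differentiable_at)
  moreover have "open (snd c ` (fst c \<inter> (N \<inter> N')))"
    by (rule open_chart_image[OF c(3) openin_Int[OF N N']])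
  moreover have "y \<in> snd c ` (fst c \<inter> (N \<inter> N'))" using c p by (auto simp: y_def)
  moreover have "\<Phi> (x, 0) = F (chart_inv c x)" if "x \<in> snd c ` (fst c \<inter> (N \<inter> N'))" for x
    using that F0 chart_inv_chart[OF c(3)] by (auto simp: \<Phi>_def)
  ultimately have "frechet_derivative (\<lambda>x. \<Phi> (x, 0)) (at y)
      = frechet_derivative (\<lambda>x. F (chart_inv c x)) (at y)"
    by (rule frechet_derivative_transform_within_open)
  with L show ?thesis
    by (intro exI[of _ L]) (simp add: mdiff initial_rate_def \<Phi>_def y_def)
qed

section \<open>Hits of a transverse section\<close>

text \<open>
  A time \<open>t\<close> with \<open>\<gamma> t = x0\<close> is an isolated zero of \<open>g\<close> along \<open>\<gamma>\<close>, since the derivative of \<open>g\<close> along \<open>\<gamma>\<close> there is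
  \<open>mdiff A g x0 (X x0)\<close> for every such \<open>t\<close>; near any other time \<open>\<gamma>\<close> avoids a neighbourhood of
  \<open>x0\<close>. Finitely many of these neighbourhoods of times cover \<open>{a..b}\<close>.
\<close>

lemma transverse_returns_isolated:
  fixes A :: "('a, 'n::finite) chart set"
  assumes Hausdorff: "Hausdorff_space M" and atlas: "oriented_Ck_atlas k M A"
    and \<gamma>: "integral_curve M A X \<gamma>"
    and S: "x0 \<in> S" "local_defining_function M A S x0 Ng g" "mdiff A g x0 (X x0) \<noteq> 0"
  shows "\<exists>V. openin M V \<and> x0 \<in> V \<and> V \<subseteq> Ng \<and> (\<forall>t\<in>{a..b}. \<gamma> t \<in> V \<inter> S \<longrightarrow> \<gamma> t = x0)"
proof -
  have Ng: "openin M Ng" "x0 \<in> Ng" and g: "Ck_function 1 A Ng g" and zero: "S \<inter> Ng = {q \<in> Ng. g q = 0}"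
    using S(2) unfolding local_defining_function_def by blast+
  have cont: "continuous_map euclideanreal M \<gamma>" using \<gamma> by (simp add: integral_curve_def)
  have x0M: "x0 \<in> topspace M" using Ng openin_subset by blast
  define P where "P t V I \<longleftrightarrow> openin M V \<and> x0 \<in> V \<and> V \<subseteq> Ng \<and> open I \<and> t \<in> I \<and>
      (\<forall>s\<in>I. \<gamma> s \<in> V \<inter> S \<longrightarrow> \<gamma> s = x0)" for t V I
  have "\<exists>V I. P t V I" for t
  proof (cases "\<gamma> t = x0")
    case True
    define c where "c = chart_at A x0"
    note c = chart_at_covers[OF atlas x0M, folded c_def]
    have "(\<lambda>x. g (chart_inv c x)) differentiable_on snd c ` (fst c \<inter> Ng)"
      using g c(1) unfolding Ck_function_def One_nat_def Ck_on.simps o_def by blast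
    moreover have "open (snd c ` (fst c \<inter> Ng))" by (rule open_chart_image[OF c(3) Ng(1)])
    moreover have "snd c x0 \<in> snd c ` (fst c \<inter> Ng)" using c Ng by blast
    ultimately have "(\<lambda>x. g (chart_inv c x)) differentiable (at (snd c x0))"
      using differentiable_on_eq_differentiable_at by blast
    then have "((\<lambda>x. g (chart_inv c x)) has_derivative
        frechet_derivative (\<lambda>x. g (chart_inv c x)) (at (snd c x0))) (at (snd c (\<gamma> t)))"
      by (simp add: frechet_derivative_works[symmetric] True)
    from has_real_derivative_along_curve[OF \<gamma> c(1,3) _ this] c(2) True
    have "((\<lambda>s. g (\<gamma> s)) has_real_derivative mdiff A g x0 (X x0)) (at t)"
      by (simp add: mdiff_def c_def Let_def o_def)
    then have "((\<lambda>s. (g (\<gamma> s) - g (\<gamma> t)) / (s - t)) \<longlongrightarrow> mdiff A g x0 (X x0)) (at t)"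
      by (simp add: has_field_derivative_iff)
    from tendsto_imp_eventually_ne[OF this S(3)]
    have "\<forall>\<^sub>F s in nhds t. s \<noteq> t \<longrightarrow> g (\<gamma> s) \<noteq> g (\<gamma> t)"
      unfolding eventually_at_filter by (auto elim: eventually_mono)
    then obtain I where I: "open I" "t \<in> I" "\<And>s. s \<in> I \<Longrightarrow> s \<noteq> t \<Longrightarrow> g (\<gamma> s) \<noteq> g (\<gamma> t)"
      unfolding eventually_nhds by blast
    moreover have "g x0 = 0" using zero S(1) Ng(2) by blast
    ultimately have "\<forall>s\<in>I. \<gamma> s \<in> Ng \<inter> S \<longrightarrow> \<gamma> s = x0"
      using zero True by (auto simp: set_eq_iff)
    with Ng I(1,2) show ?thesis unfolding P_def by blast
  next
    case False
    have "\<gamma> t \<in> topspace M" using cont by (simp add: continuous_map_def Pi_iff)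
    then obtain U V where UV: "openin M U" "openin M V" "\<gamma> t \<in> U" "x0 \<in> V" "disjnt U V"
      using Hausdorff x0M False unfolding Hausdorff_space_def by blast
    obtain I where "open I" "t \<in> I" "\<And>s. s \<in> I \<Longrightarrow> \<gamma> s \<in> U"
      using eventually_curve_in[OF cont UV(1,3)] unfolding eventually_nhds by blast
    with UV Ng show ?thesis
      unfolding P_def by (intro exI[of _ "V \<inter> Ng"] exI[of _ I]) (auto simp: disjnt_iff)
  qed
  then obtain V I where P: "\<And>t. P t (V t) (I t)" by metis
  have V: "openin M (V t)" "x0 \<in> V t" "V t \<subseteq> Ng" and I: "open (I t)" "t \<in> I t"
    and iso: "s \<in> I t \<Longrightarrow> \<gamma> s \<in> V t \<inter> S \<Longrightarrow> \<gamma> s = x0" for s t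
    using P[of t] unfolding P_def by blast+
  have "{a..b} \<subseteq> (\<Union>t\<in>{a..b}. I t)" using I(2) by blast
  then obtain C where C: "C \<subseteq> {a..b}" "finite C" "{a..b} \<subseteq> (\<Union>t\<in>C. I t)"
    by (rule compactE_image[OF compact_Icc I(1)])
  show ?thesis
  proof (intro exI conjI)
    show "openin M (\<Inter>(insert Ng (V ` C)))"
      using C(2) Ng V(1) by (intro openin_Inter) auto
    show "\<forall>t\<in>{a..b}. \<gamma> t \<in> \<Inter> (insert Ng (V ` C)) \<inter> S \<longrightarrow> \<gamma> t = x0"
    proof (intro ballI impI)
      fix t assume t: "t \<in> {a..b}" "\<gamma> t \<in> \<Inter> (insert Ng (V ` C)) \<inter> S"
      then obtain u where "u \<in> C" "t \<in> I u" using C(3) by blast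
      with t iso[of t u] show "\<gamma> t = x0" by blast
    qed
  qed (use Ng V in auto)
qed

text \<open>
  The set \<open>K\<close> of zeros of \<open>g\<close> in a closed coordinate ball around \<open>x0\<close> is compact, hence closed in the
  Hausdorff space \<open>M\<close>, and meets \<open>\<Gamma>\<close> at most in \<open>x0\<close>. For an open \<open>U\<close> around \<open>x0\<close>, the complement of
  \<open>K - U\<close> is therefore an open neighbourhood of \<open>\<Gamma>\<close>, which \<open>h\<close> eventually enters; points of the section
  in the open ball lie in \<open>K\<close>, so \<open>h\<close> is then in \<open>U\<close>. The set \<open>W0\<close> is independent of \<open>h\<close>, and hence of
  the smaller piece of the section that produces the hits.
\<close>

lemma section_hits_converge:
  fixes A :: "('a, 'n::finite) chart set"
  assumes Hausdorff: "Hausdorff_space M" and atlas: "oriented_Ck_atlas k M A"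
    and S: "local_defining_function M A S x0 Ng g"
    and V: "openin M V" "x0 \<in> V" "V \<subseteq> Ng" "V \<inter> S \<inter> \<Gamma> \<subseteq> {x0}"
    and \<Gamma>: "\<Gamma> \<subseteq> topspace M"
  shows "\<exists>W0. openin M W0 \<and> x0 \<in> W0 \<and>
    (\<forall>(h :: 'i \<Rightarrow> 'a) \<F>. (\<forall>\<^sub>F i in \<F>. h i \<in> S \<inter> W0) \<and>
       (\<forall>W. openin M W \<and> \<Gamma> \<subseteq> W \<longrightarrow> (\<forall>\<^sub>F i in \<F>. h i \<in> W)) \<longrightarrow> limitin M h x0 \<F>)"
proof -
  have g: "Ck_function 1 A Ng g" and zero: "S \<inter> Ng = {q \<in> Ng. g q = 0}"
    using S unfolding local_defining_function_def by blast+
  have x0M: "x0 \<in> topspace M" using V openin_subset by blast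
  define c where "c = chart_at A x0"
  note c = chart_at_covers[OF atlas x0M, folded c_def]
  have "open (snd c ` (fst c \<inter> V))" by (rule open_chart_image[OF c(3) V(1)])
  moreover have "snd c x0 \<in> snd c ` (fst c \<inter> V)" using c V by blast
  ultimately obtain r where r: "r > 0" "cball (snd c x0) r \<subseteq> snd c ` (fst c \<inter> V)"
    using open_contains_cball by blast
  define W0 where "W0 = {q \<in> fst c. snd c q \<in> ball (snd c x0) r}"
  define Y where "Y = cball (snd c x0) r \<inter> (\<lambda>x. g (chart_inv c x)) -` {0}"
  define K where "K = chart_inv c ` Y"
  have Y: "Y \<subseteq> snd c ` (fst c \<inter> V)" using r by (auto simp: Y_def)
  have "closedin M K"
  proof -
    have "(\<lambda>x. g (chart_inv c x)) differentiable_on snd c ` (fst c \<inter> Ng)"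
      using g c(1) unfolding Ck_function_def One_nat_def Ck_on.simps o_def by blast
    then have "continuous_on (cball (snd c x0) r) (\<lambda>x. g (chart_inv c x))"
      using r V(3) by (blast intro: differentiable_imp_continuous_on continuous_on_subset)
    then have "closed Y" unfolding Y_def by (intro continuous_closed_preimage) auto
    then have "compact Y"
      using compact_Int_closed[of "cball (snd c x0) r" Y] by (simp add: Y_def Int_absorb1)
    then have "compactin (top_of_set (snd c ` fst c)) Y"
      using Y by (auto simp: compactin_subtopology)
    then have "compactin M K"
      unfolding K_def using image_compactin continuous_map_chart_inv[OF c(3)] by blast
    then show ?thesis using Hausdorff compactin_imp_closedin by blast
  qed
  have K: "K \<inter> \<Gamma> \<subseteq> {x0}"
  proof -
    have "chart_inv c y \<in> V \<inter> S" if y: "y \<in> Y" for y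
    proof -
      obtain q where "q \<in> fst c \<inter> V" "y = snd c q" using y Y by blast
      then have "chart_inv c y \<in> V" using chart_inv_chart[OF c(3)] by auto
      moreover have "g (chart_inv c y) = 0" using y by (simp add: Y_def)
      ultimately show ?thesis using zero V(3) by blast
    qed
    then have "K \<subseteq> V \<inter> S" by (auto simp: K_def)
    then show ?thesis using V(4) by blast
  qed
  have hit: "q \<in> K" if "q \<in> S \<inter> W0" for q
  proof -
    have q: "q \<in> fst c" "snd c q \<in> cball (snd c x0) r" using that by (auto simp: W0_def)
    then have "snd c q \<in> snd c ` (fst c \<inter> V)" using r(2) by blast
    then obtain q' where q': "q' \<in> fst c" "q' \<in> V" "snd c q = snd c q'" by auto
    have "q = chart_inv c (snd c q')" using chart_inv_chart[OF c(3) q(1)] q'(3) by simp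
    then have "q \<in> V" using chart_inv_chart[OF c(3) q'(1)] q'(2) by simp
    then have "g q = 0" using that zero V(3) by blast
    then show ?thesis
      using q chart_inv_chart[OF c(3), of q] unfolding K_def Y_def by (intro image_eqI[of _ _ "snd c q"]) auto
  qed
  show ?thesis
  proof (intro exI conjI allI impI)
    show "openin M W0" unfolding W0_def by (rule openin_chart_preimage[OF c(3)]) simp
    show "x0 \<in> W0" using c r by (simp add: W0_def)
    fix h :: "'i \<Rightarrow> 'a" and \<F>
    assume h: "(\<forall>\<^sub>F i in \<F>. h i \<in> S \<inter> W0) \<and>
       (\<forall>W. openin M W \<and> \<Gamma> \<subseteq> W \<longrightarrow> (\<forall>\<^sub>F i in \<F>. h i \<in> W))"
    show "limitin M h x0 \<F>"
      unfolding limitin_def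
    proof (intro conjI allI impI)
      fix U assume U: "openin M U \<and> x0 \<in> U"
      then have "openin M (topspace M - (K - U))"
        using \<open>closedin M K\<close> by (intro openin_diff closedin_diff) auto
      moreover have "\<Gamma> \<subseteq> topspace M - (K - U)" using \<Gamma> K U by blast
      ultimately have "\<forall>\<^sub>F i in \<F>. h i \<in> topspace M - (K - U)" using h by blast
      moreover have "\<forall>\<^sub>F i in \<F>. h i \<in> S \<inter> W0" using h by blast
      ultimately show "\<forall>\<^sub>F i in \<F>. h i \<in> U"
        by eventually_elim (use hit in blast)
    qed (rule x0M)
  qed
qed

section \<open>Vanishing of the integral\<close>

theorem theorem2p4:
  fixes M :: "'a topology"
    and A :: "('a, 'n::finite) chart set"
    and e0 T :: real
    and X :: "real \<Rightarrow> 'a \<Rightarrow> ('a, 'n) tvec"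
    and X0 X1 :: "'a \<Rightarrow> ('a, 'n) tvec"
    and \<gamma>p \<gamma>h :: "real \<Rightarrow> 'a"
    and \<Gamma>p \<Gamma>h N N' :: "'a set"
    and F :: "'a \<Rightarrow> real"
    and F\<epsilon> :: "real \<Rightarrow> 'a \<Rightarrow> real"
  defines "\<Gamma>p \<equiv> \<gamma>p ` {0..<T}"
    and "\<Gamma>h \<equiv> range \<gamma>h \<union> \<Gamma>p"
  assumes dim: "CARD('n) \<ge> 2"
    and M: "paracompact_oriented_Ck_manifold 3 M A"
    and e0: "e0 > 0"
    and X: "Ck_vector_field_family 2 M A e0 X"
    and expansion: "first_order_expansion A X X0 X1"
    and periodic: "periodic_orbit M A X0 T \<gamma>p"
    and homoclinic: "homoclinic_orbit M A X0 \<Gamma>p \<gamma>h"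
    and N: "openin M N" "\<Gamma>h \<subseteq> N"
    and F: "Ck_function 3 A N F" "first_integral A N X0 F" "\<not> F constant_on N"
    and N': "openin M N'" "\<Gamma>h \<subseteq> N'"
    and F\<epsilon>: "\<And>\<epsilon>. \<epsilon> \<in> {0..<e0} \<Longrightarrow> Ck_function 3 A N' (F\<epsilon> \<epsilon>)"
            "\<And>\<epsilon>. \<epsilon> \<in> {0..<e0} \<Longrightarrow> first_integral A N' (X \<epsilon>) (F\<epsilon> \<epsilon>)"
            "Ck_function_family 2 A N' e0 F\<epsilon>"
    and F0: "\<And>p. p \<in> N \<inter> N' \<Longrightarrow> F\<epsilon> 0 p = F p"
  shows "let f = (\<lambda>t. mdiff A F (\<gamma>h t) (X1 (\<gamma>h t)));
             x0 = \<gamma>p 0;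
             vanishes = (\<lambda>\<tau> :: int \<Rightarrow> real.
               (\<lambda>k::nat. integral {\<tau> (- int k)..\<tau> (int k)} f) \<longlonglongrightarrow> 0)
         in (\<forall>a b. f integrable_on {a..b}) \<and>
            (is_equilibrium \<gamma>p \<longrightarrow>
               (\<forall>\<tau>. biinfinite_time_sequence \<tau> \<longrightarrow> vanishes \<tau>) \<and>
               ((\<lambda>(a, b). integral {a..b} f) \<longlongrightarrow> 0) (at_bot \<times>\<^sub>F at_top)) \<and>
            (\<not> is_equilibrium \<gamma>p \<longrightarrow>
               (\<forall>\<Sigma>. hypersurface M A \<Sigma> \<and> transverse_at M A \<Sigma> x0 (X0 x0) \<longrightarrow>
                  (\<exists>W0. openin M W0 \<and> x0 \<in> W0 \<and>
                     (\<forall>W \<tau>. openin M W \<and> x0 \<in> W \<and> W \<subseteq> W0 \<and>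
                        crossing_times M A X0 (\<Sigma> \<inter> W) \<gamma>h \<tau> \<longrightarrow> vanishes \<tau>))))"
proof -
  define G where "G = initial_rate F\<epsilon>"
  define f where "f = (\<lambda>t. mdiff A F (\<gamma>h t) (X1 (\<gamma>h t)))"
  define x0 where "x0 = \<gamma>p 0"
  have Hausdorff: "Hausdorff_space M" and atlas: "oriented_Ck_atlas 3 M A"
    using M by (auto simp: paracompact_oriented_Ck_manifold_def)
  have p_curve: "integral_curve M A X0 \<gamma>p" and "T > 0" using periodic by (auto simp: periodic_orbit_def)
  have h_curve: "integral_curve M A X0 \<gamma>h" using homoclinic by (simp add: homoclinic_orbit_def)
  have h_near: "(\<forall>\<^sub>F t in at_top. \<gamma>h t \<in> W) \<and> (\<forall>\<^sub>F t in at_bot. \<gamma>h t \<in> W)"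
    if "openin M W" "\<Gamma>p \<subseteq> W" for W
    using homoclinic that unfolding homoclinic_orbit_def by blast
  have x0: "x0 \<in> \<Gamma>p" using \<open>T > 0\<close> by (simp add: x0_def \<Gamma>p_def)
  then have x0_N: "x0 \<in> N \<inter> N'" using N(2) N'(2) by (auto simp: \<Gamma>h_def)
  have \<Gamma>p_M: "\<Gamma>p \<subseteq> topspace M" using N openin_subset[OF N(1)] by (auto simp: \<Gamma>h_def)
  then have x0_M: "x0 \<in> topspace M" using x0 by blast
  have "Ck_function 3 A N' (F\<epsilon> 0)" using F\<epsilon>(1)[of 0] e0 by simp
  from initial_rate_derivative[OF atlas e0 X expansion N(1) N'(1) F\<epsilon>(3) this F\<epsilon>(2) F0 _ refl]
  have rate: "\<exists>L. ((\<lambda>y. G (chart_inv (chart_at A p) y)) has_derivative L) (at (snd (chart_at A p) p)) \<and>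
      L (X0 p (chart_at A p)) = - mdiff A F p (X1 p)" if "p \<in> N \<inter> N'" for p
    using that unfolding G_def by blast
  have "((\<lambda>t. G (\<gamma>h t)) has_real_derivative - f t) (at t)" for t
  proof -
    have t: "\<gamma>h t \<in> N \<inter> N'" using N(2) N'(2) by (auto simp: \<Gamma>h_def)
    then have "\<gamma>h t \<in> topspace M" using openin_subset[OF N(1)] by blast
    note c = chart_at_covers[OF atlas this]
    obtain L where L: "((\<lambda>y. G (chart_inv (chart_at A (\<gamma>h t)) y)) has_derivative L)
        (at (snd (chart_at A (\<gamma>h t)) (\<gamma>h t)))"
      "L (X0 (\<gamma>h t) (chart_at A (\<gamma>h t))) = - f t"
      using rate[OF t] unfolding f_def by blast
    from has_real_derivative_along_curve[OF h_curve c(1,3,2) L(1)] L(2) show ?thesis by simp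
  qed
  then have "((\<lambda>t. - G (\<gamma>h t)) has_vector_derivative f t) (at t within I)" for t I
    using DERIV_minus[of "\<lambda>t. G (\<gamma>h t)" "- f t" t]
    by (simp add: has_vector_derivative_at_within has_real_derivative_iff_has_vector_derivative)
  from fundamental_theorem_of_calculus[OF _ this]
  have FTC: "(f has_integral G (\<gamma>h a) - G (\<gamma>h b)) {a..b}" if "a \<le> b" for a b
    using that by fastforce
  have integrable: "f integrable_on {a..b}" for a b
    using FTC[of a b] by (cases "a \<le> b") auto
  have G_lim: "((\<lambda>i. G (h i)) \<longlongrightarrow> G x0) \<F>" if "limitin M h x0 \<F>"
    for h :: "'i \<Rightarrow> 'a" and \<F>
  proof -
    note c = chart_at_covers[OF atlas x0_M]
    have "isCont (\<lambda>y. G (chart_inv (chart_at A x0) y)) (snd (chart_at A x0) x0)"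
      using rate[OF x0_N] has_derivative_continuous by blast
    from tendsto_along_limitin[OF that c(3,2) this] show ?thesis .
  qed
  have vanishing: "((\<lambda>i. integral {\<alpha> i..\<beta> i} f) \<longlongrightarrow> 0) \<F>"
    if "((\<lambda>i. G (\<gamma>h (\<alpha> i))) \<longlongrightarrow> G x0) \<F>" "((\<lambda>i. G (\<gamma>h (\<beta> i))) \<longlongrightarrow> G x0) \<F>"
      "\<forall>\<^sub>F i in \<F>. \<alpha> i \<le> \<beta> i" for \<alpha> \<beta> :: "'i \<Rightarrow> real" and \<F>
  proof -
    have "((\<lambda>i. G (\<gamma>h (\<alpha> i)) - G (\<gamma>h (\<beta> i))) \<longlongrightarrow> 0) \<F>"
      using tendsto_diff[OF that(1,2)] by simp
    moreover have "\<forall>\<^sub>F i in \<F>. G (\<gamma>h (\<alpha> i)) - G (\<gamma>h (\<beta> i)) = integral {\<alpha> i..\<beta> i} f"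
      using that(3) by eventually_elim (simp add: integral_unique[OF FTC])
    ultimately show ?thesis by (rule Lim_transform_eventually)
  qed
  have times: "filterlim (\<lambda>k. \<tau> (int k)) at_top sequentially"
    "filterlim (\<lambda>k. \<tau> (- int k)) at_bot sequentially"
    "\<tau> (- int k) \<le> \<tau> (int k)" if "biinfinite_time_sequence \<tau>" for \<tau> k
  proof -
    have \<tau>: "strict_mono \<tau>" "filterlim \<tau> at_top at_top" "filterlim \<tau> at_bot at_bot"
      using that by (auto simp: biinfinite_time_sequence_def)
    have "filterlim (\<lambda>k. - int k) at_bot sequentially"
      unfolding filterlim_at_bot
    proof
      show "\<forall>\<^sub>F k in sequentially. - int k \<le> Z" for Z
        using eventually_ge_at_top[of "nat (- Z)"] by eventually_elim linarith
    qed
    then show "filterlim (\<lambda>k. \<tau> (- int k)) at_bot sequentially"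
      by (rule filterlim_compose[OF \<tau>(3)])
    show "filterlim (\<lambda>k. \<tau> (int k)) at_top sequentially"
      by (rule filterlim_compose[OF \<tau>(2) filterlim_int_sequentially])
    show "\<tau> (- int k) \<le> \<tau> (int k)"
      using strict_mono_mono[OF \<tau>(1)] by (rule monoD) simp
  qed
  have equilibrium: "((\<lambda>t. G (\<gamma>h t)) \<longlongrightarrow> G x0) at_top \<and> ((\<lambda>t. G (\<gamma>h t)) \<longlongrightarrow> G x0) at_bot"
    if "is_equilibrium \<gamma>p"
  proof -
    have "\<Gamma>p \<subseteq> {x0}" using that by (auto simp: \<Gamma>p_def x0_def is_equilibrium_def)
    then have "limitin M \<gamma>h x0 at_top" "limitin M \<gamma>h x0 at_bot"
      using h_near x0_M unfolding limitin_def by blast+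
    then show ?thesis using G_lim by blast
  qed
  have eq1: "(\<lambda>k. integral {\<tau> (- int k)..\<tau> (int k)} f) \<longlonglongrightarrow> 0"
    if "is_equilibrium \<gamma>p" "biinfinite_time_sequence \<tau>" for \<tau>
    using equilibrium[OF that(1)] times[OF that(2)]
    by (intro vanishing always_eventually allI) (auto intro: filterlim_compose)
  have eq2: "((\<lambda>(a, b). integral {a..b} f) \<longlongrightarrow> 0) (at_bot \<times>\<^sub>F at_top)"
    if "is_equilibrium \<gamma>p"
  proof -
    have "\<forall>\<^sub>F i in at_bot \<times>\<^sub>F at_top. fst i \<le> (0 :: real) \<and> (0 :: real) \<le> snd i"
      unfolding eventually_prod_filter using eventually_le_at_bot eventually_ge_at_top by fastforce
    then have "\<forall>\<^sub>F i in at_bot \<times>\<^sub>F at_top. fst i \<le> (snd i :: real)"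
      by (rule eventually_mono) linarith
    then have "((\<lambda>i. integral {fst i..snd i} f) \<longlongrightarrow> 0) (at_bot \<times>\<^sub>F at_top)"
      using equilibrium[OF that]
      by (intro vanishing) (auto intro: filterlim_compose filterlim_fst filterlim_snd)
    then show ?thesis by (simp add: case_prod_unfold)
  qed
  have noneq: "\<exists>W0. openin M W0 \<and> x0 \<in> W0 \<and> (\<forall>W \<tau>. openin M W \<and> x0 \<in> W \<and> W \<subseteq> W0 \<and>
      crossing_times M A X0 (\<Sigma> \<inter> W) \<gamma>h \<tau> \<longrightarrow>
      (\<lambda>k. integral {\<tau> (- int k)..\<tau> (int k)} f) \<longlonglongrightarrow> 0)"
    if transverse: "transverse_at M A \<Sigma> x0 (X0 x0)" for \<Sigma>
  proof -
    obtain Ng g where g: "x0 \<in> \<Sigma>" "local_defining_function M A \<Sigma> x0 Ng g" "mdiff A g x0 (X0 x0) \<noteq> 0"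
      using transverse unfolding transverse_at_def by blast
    obtain V where V: "openin M V" "x0 \<in> V" "V \<subseteq> Ng" "\<forall>t\<in>{0..T}. \<gamma>p t \<in> V \<inter> \<Sigma> \<longrightarrow> \<gamma>p t = x0"
      using transverse_returns_isolated[OF Hausdorff atlas p_curve g] by blast
    have "V \<inter> \<Sigma> \<inter> \<Gamma>p \<subseteq> {x0}" using V(4) by (auto simp: \<Gamma>p_def)
    from section_hits_converge[OF Hausdorff atlas g(2) V(1-3) this \<Gamma>p_M]
    obtain W0 where W0: "openin M W0" "x0 \<in> W0"
      and lim: "\<And>(h :: nat \<Rightarrow> 'a) \<F>. \<forall>\<^sub>F i in \<F>. h i \<in> \<Sigma> \<inter> W0 \<Longrightarrow>
        (\<And>W. openin M W \<Longrightarrow> \<Gamma>p \<subseteq> W \<Longrightarrow> \<forall>\<^sub>F i in \<F>. h i \<in> W) \<Longrightarrow> limitin M h x0 \<F>"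
      by metis
    have "(\<lambda>k. integral {\<tau> (- int k)..\<tau> (int k)} f) \<longlonglongrightarrow> 0"
      if "W \<subseteq> W0" and crossing: "crossing_times M A X0 (\<Sigma> \<inter> W) \<gamma>h \<tau>" for W \<tau>
    proof -
      have \<tau>: "biinfinite_time_sequence \<tau>" "{t. \<gamma>h t \<in> \<Sigma> \<inter> W} = range \<tau>"
        using crossing by (auto simp: crossing_times_def)
      have hit: "\<gamma>h (\<tau> j) \<in> \<Sigma> \<inter> W0" for j
        using \<tau>(2) \<open>W \<subseteq> W0\<close> by blast
      have "limitin M (\<lambda>k. \<gamma>h (\<tau> (int k))) x0 sequentially"
        using h_near times(1)[OF \<tau>(1)]
        by (intro lim) (auto simp: hit[simplified] filterlim_iff)
      moreover have "limitin M (\<lambda>k. \<gamma>h (\<tau> (- int k))) x0 sequentially"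
        using h_near times(2)[OF \<tau>(1)]
        by (intro lim) (auto simp: hit[simplified] filterlim_iff)
      ultimately show ?thesis
        using times(3)[OF \<tau>(1)] by (intro vanishing G_lim) auto
    qed
    with W0 show ?thesis by blast
  qed
  show ?thesis
    unfolding Let_def f_def[symmetric] x0_def[symmetric]
    using integrable eq1 eq2 noneq by blast
qed

end
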